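(* Let $C$, $J$ and $\mathbf{P}$ be sets, each with at least three elements, let $h:C\to J$ and $H:C\to\mathbf{P}$ be bijections, and let $\Gamma\cup\{\sigma\}\subseteq BN(C)$. Let $(\Gamma',\sigma',T)$ be any one of the three triples $$(\Gamma,\sigma,DF(C)),\qquad(\Gamma^{h},\sigma^{h},SF(J)),\qquad(\Gamma^{H},\sigma^{H},MF(\mathbf{P})).$$ Then: 1. $\Gamma$ is consistent if and only if $\Gamma'\cup T$ is consistent. 2. $\Gamma\vdash^{g}\sigma$ if and only if $\Gamma'\cup T\vdash\sigma'$.
   Context: Natural deduction system: $BN(C)$ is the set of all strings (basic sentences) $Yab$ with $Y\in\{A,E,I,O\}$, $a,b\in C$ ($a=b$ allowed). Contradictories: $\widehat{Aab}=Oab$, $\widehat{Oab}=Aab$, $\widehat{Eab}=Iab$, $\widehat{Iab}=Eab$. The $d$-rules (for all $a,b,c\in C$): (A-Id) infer $Aaa$ from no premises; (Apc) from $Aab$ infer $Iba$; (Ec) from $Eab$ infer $Eba$; (Barbara) from $Aab,Abc$ infer $Aac$; (Celarent) from $Aab,Ebc$ infer $Eac$. $\Gamma\vdash^{d}\sigma$ means that there is a finite nonempty sequence of basic sentences ending in $\sigma$, each of whose terms is in $\Gamma$ or is the conclusion of a $d$-rule instance whose premises are earlier terms. $\Gamma$ is inconsistent if $\Gamma\vdash^{d}\sigma$ and $\Gamma\vdash^{d}\widehat\sigma$ for some $\sigma\in BN(C)$, and consistent otherwise. $\Gamma\vdash^{g}\sigma$ means that $\Gamma\cup\{\widehat\sigma\}$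 is inconsistent. $DF(C)$: the first order theory in the language with four binary relation symbols $A,E,I,O$ and the elements of $C$ as individual constants (with or without equality), whose non-logical axioms are the universal closures of: $Exy\leftrightarrow\neg Ixy$; $Oxy\leftrightarrow\neg Axy$; $Axx$; $Axy\to Iyx$; $Exy\to Eyx$; $Axy\wedge Ayz\to Axz$; $Axy\wedge Eyz\to Exz$. Elements of $BN(C)$ are regarded as atomic sentences of this language. $SF(J)$: the theory in the propositional (sentential) language whose sentential symbols are pairwise distinct symbols $Aij,Eij,Iij,Oij$ ($i,j\in J$), with non-logical axioms, for all $i,j,k\in J$: $Eij\leftrightarrow\neg Iij$; $Oij\leftrightarrow\neg Aij$; $Aii$; $Aij\to Iji$; $Eij\to Eji$; $Aij\wedge Ajk\to Aik$; $Aij\wedge Ejk\to Eik$. Deduction is classical propositional deduction. $MF(\mathbf{P})$: the first order theory in the language (with or without equality) whose non-logical constants are the elements of $\mathbf{P}$, all unary relation symbols. Abbreviations: $APQ$ is $\forall x(Px\to Qx)$, $EPQ$ is $\forall x(Px\to\neg Qx)$, $IPQ$ is $\exists x(Px\wedge Qx)$, $OPQ$ is $\exists x(Px\wedge\neg Qx)$. Its non-logical axioms are all sentences $APQ\to IQP$ with $P,Q\in\mathbf{P}$ (equivalently, all $\exists x\,Px$). For $Yab\in BN(C)$, $(Yab)^{h}=Y\,h(a)\,h(b)$ and $(Yab)^{H}=Y\,H(a)\,H(b)$; $\Gamma^{h}$ and $\Gamma^{H}$ are the corresponding images of $\Gamma$. For $T$ among the three theories, $\vdash$ is the usual (first order,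 respectively propositional) provability and consistency has the usual meaning. *)

theory Defs
  imports Main
begin

section \<open>Basic sentences and the natural deduction system\<close>

datatype quant = qA | qE | qI | qO

datatype 'c basic = Basic quant 'c 'c

definition BN :: "'c set \<Rightarrow> 'c basic set" where
  "BN C = {Basic Y a b | Y a b. a \<in> C \<and> b \<in> C}"

fun contradictory :: "'c basic \<Rightarrow> 'c basic" where
  "contradictory (Basic qA a b) = Basic qO a b"
| "contradictory (Basic qO a b) = Basic qA a b"
| "contradictory (Basic qE a b) = Basic qI a b"
| "contradictory (Basic qI a b) = Basic qE a b"

text \<open>\<open>d_rule C \<Pi> \<sigma>\<close>: there is an instance over \<open>C\<close> of a d-rule with
  set of premises \<open>\<Pi>\<close> and conclusion \<open>\<sigma>\<close>.\<close>

inductive d_rule :: "'c set \<Rightarrow> 'c basic set \<Rightarrow> 'c basic \<Rightarrow> bool" for C where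
  A_Id: "a \<in> C \<Longrightarrow> d_rule C {} (Basic qA a a)"
| Apc: "a \<in> C \<Longrightarrow> b \<in> C \<Longrightarrow> d_rule C {Basic qA a b} (Basic qI b a)"
| Ec: "a \<in> C \<Longrightarrow> b \<in> C \<Longrightarrow> d_rule C {Basic qE a b} (Basic qE b a)"
| Barbara: "a \<in> C \<Longrightarrow> b \<in> C \<Longrightarrow> c \<in> C \<Longrightarrow>
    d_rule C {Basic qA a b, Basic qA b c} (Basic qA a c)"
| Celarent: "a \<in> C \<Longrightarrow> b \<in> C \<Longrightarrow> c \<in> C \<Longrightarrow>
    d_rule C {Basic qA a b, Basic qE b c} (Basic qE a c)"

definition d_derives :: "'c set \<Rightarrow> 'c basic set \<Rightarrow> 'c basic \<Rightarrow> bool" where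
  "d_derives C \<Gamma> \<sigma> \<longleftrightarrow>
    (\<exists>ss. ss \<noteq> [] \<and> set ss \<subseteq> BN C \<and> last ss = \<sigma> \<and>
      (\<forall>i<length ss. ss ! i \<in> \<Gamma> \<or> (\<exists>\<Pi>. d_rule C \<Pi> (ss ! i) \<and> \<Pi> \<subseteq> set (take i ss))))"

definition d_inconsistent :: "'c set \<Rightarrow> 'c basic set \<Rightarrow> bool" where
  "d_inconsistent C \<Gamma> \<longleftrightarrow>
    (\<exists>\<sigma>\<in>BN C. d_derives C \<Gamma> \<sigma> \<and> d_derives C \<Gamma> (contradictory \<sigma>))"

abbreviation d_consistent :: "'c set \<Rightarrow> 'c basic set \<Rightarrow> bool" where
  "d_consistent C \<Gamma> \<equiv> \<not> d_inconsistent C \<Gamma>"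

definition g_derives :: "'c set \<Rightarrow> 'c basic set \<Rightarrow> 'c basic \<Rightarrow> bool" where
  "g_derives C \<Gamma> \<sigma> \<longleftrightarrow> d_inconsistent C (\<Gamma> \<union> {contradictory \<sigma>})"


section \<open>First order logic\<close>

text \<open>Languages with relation symbols and individual constants, with or without equality; function
  symbols of positive arity are not needed. Variables are de Bruijn indices.\<close>

datatype 'k tm = Var nat | Const 'k

datatype ('r, 'k) fm =
    Rel 'r "'k tm list"
  | Eq "'k tm" "'k tm"
  | Falsum
  | Imp "('r, 'k) fm" "('r, 'k) fm"
  | All "('r, 'k) fm"

abbreviation Neg :: "('r, 'k) fm \<Rightarrow> ('r, 'k) fm" where
  "Neg p \<equiv> Imp p Falsum"
abbreviation And :: "('r, 'k) fm \<Rightarrow> ('r, 'k) fm \<Rightarrow> ('r, 'k) fm" where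
  "And p q \<equiv> Neg (Imp p (Neg q))"
abbreviation Iff :: "('r, 'k) fm \<Rightarrow> ('r, 'k) fm \<Rightarrow> ('r, 'k) fm" where
  "Iff p q \<equiv> And (Imp p q) (Imp q p)"
abbreviation Ex :: "('r, 'k) fm \<Rightarrow> ('r, 'k) fm" where
  "Ex p \<equiv> Neg (All (Neg p))"

record ('r, 'k) lang =
  rels :: "'r set"
  arity :: "'r \<Rightarrow> nat"
  constants :: "'k set"
  has_eq :: bool

fun tm_in :: "('r, 'k) lang \<Rightarrow> 'k tm \<Rightarrow> bool" where
  "tm_in L (Var n) \<longleftrightarrow> True"
| "tm_in L (Const k) \<longleftrightarrow> k \<in> constants L"

fun fm_in :: "('r, 'k) lang \<Rightarrow> ('r, 'k) fm \<Rightarrow> bool" where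
  "fm_in L (Rel r ts) \<longleftrightarrow> r \<in> rels L \<and> length ts = arity L r \<and> (\<forall>t\<in>set ts. tm_in L t)"
| "fm_in L (Eq s t) \<longleftrightarrow> has_eq L \<and> tm_in L s \<and> tm_in L t"
| "fm_in L Falsum \<longleftrightarrow> True"
| "fm_in L (Imp p q) \<longleftrightarrow> fm_in L p \<and> fm_in L q"
| "fm_in L (All p) \<longleftrightarrow> fm_in L p"

fun lift_tm :: "nat \<Rightarrow> 'k tm \<Rightarrow> 'k tm" where
  "lift_tm n (Var i) = (if i < n then Var i else Var (Suc i))"
| "lift_tm n (Const k) = Const k"

fun lift_fm :: "nat \<Rightarrow> ('r, 'k) fm \<Rightarrow> ('r, 'k) fm" where
  "lift_fm n (Rel r ts) = Rel r (map (lift_tm n) ts)"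
| "lift_fm n (Eq s t) = Eq (lift_tm n s) (lift_tm n t)"
| "lift_fm n Falsum = Falsum"
| "lift_fm n (Imp p q) = Imp (lift_fm n p) (lift_fm n q)"
| "lift_fm n (All p) = All (lift_fm (Suc n) p)"

text \<open>\<open>subst_fm n u p\<close> replaces index \<open>n\<close> by \<open>u\<close> and lowers the indices above \<open>n\<close>.\<close>

fun subst_tm :: "nat \<Rightarrow> 'k tm \<Rightarrow> 'k tm \<Rightarrow> 'k tm" where
  "subst_tm n u (Var i) = (if i < n then Var i else if i = n then u else Var (i - 1))"
| "subst_tm n u (Const k) = Const k"

fun subst_fm :: "nat \<Rightarrow> 'k tm \<Rightarrow> ('r, 'k) fm \<Rightarrow> ('r, 'k) fm" where
  "subst_fm n u (Rel r ts) = Rel r (map (subst_tm n u) ts)"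
| "subst_fm n u (Eq s t) = Eq (subst_tm n u s) (subst_tm n u t)"
| "subst_fm n u Falsum = Falsum"
| "subst_fm n u (Imp p q) = Imp (subst_fm n u p) (subst_fm n u q)"
| "subst_fm n u (All p) = All (subst_fm (Suc n) (lift_tm 0 u) p)"

text \<open>Classical natural deduction in which only formulas of the language \<open>L\<close> occur. Lifting the
  assumptions in \<open>AllI\<close> makes index 0 a fresh variable.\<close>

inductive fo_provable :: "('r, 'k) lang \<Rightarrow> ('r, 'k) fm set \<Rightarrow> ('r, 'k) fm \<Rightarrow> bool" for L where
  Assm: "p \<in> S \<Longrightarrow> fm_in L p \<Longrightarrow> fo_provable L S p"
| ImpI: "fm_in L p \<Longrightarrow> fo_provable L (insert p S) q \<Longrightarrow> fo_provable L S (Imp p q)"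
| ImpE: "fo_provable L S (Imp p q) \<Longrightarrow> fo_provable L S p \<Longrightarrow> fo_provable L S q"
| RAA: "fm_in L p \<Longrightarrow> fo_provable L (insert (Neg p) S) Falsum \<Longrightarrow> fo_provable L S p"
| AllI: "fo_provable L (lift_fm 0 ` S) p \<Longrightarrow> fo_provable L S (All p)"
| AllE: "fo_provable L S (All p) \<Longrightarrow> tm_in L t \<Longrightarrow> fo_provable L S (subst_fm 0 t p)"
| EqI: "has_eq L \<Longrightarrow> tm_in L t \<Longrightarrow> fo_provable L S (Eq t t)"
| EqE: "fm_in L p \<Longrightarrow> fo_provable L S (Eq s t) \<Longrightarrow> fo_provable L S (subst_fm 0 s p) \<Longrightarrow>
    fo_provable L S (subst_fm 0 t p)"

definition fo_consistent :: "('r, 'k) lang \<Rightarrow> ('r, 'k) fm set \<Rightarrow> bool" where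
  "fo_consistent L S \<longleftrightarrow> \<not> (\<exists>p. fm_in L p \<and> fo_provable L S p \<and> fo_provable L S (Neg p))"


section \<open>Sentential logic\<close>

datatype (symbols: 'a) pfm =
    Symb 'a
  | PFalsum
  | PImp "'a pfm" "'a pfm"

abbreviation PNeg :: "'a pfm \<Rightarrow> 'a pfm" where
  "PNeg p \<equiv> PImp p PFalsum"
abbreviation PAnd :: "'a pfm \<Rightarrow> 'a pfm \<Rightarrow> 'a pfm" where
  "PAnd p q \<equiv> PNeg (PImp p (PNeg q))"
abbreviation PIff :: "'a pfm \<Rightarrow> 'a pfm \<Rightarrow> 'a pfm" where
  "PIff p q \<equiv> PAnd (PImp p q) (PImp q p)"

text \<open>Classical natural deduction in which only formulas over the set \<open>X\<close> of sentential symbols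
  occur.\<close>

inductive prop_provable :: "'a set \<Rightarrow> 'a pfm set \<Rightarrow> 'a pfm \<Rightarrow> bool" for X where
  PAssm: "p \<in> S \<Longrightarrow> symbols p \<subseteq> X \<Longrightarrow> prop_provable X S p"
| PImpI: "symbols p \<subseteq> X \<Longrightarrow> prop_provable X (insert p S) q \<Longrightarrow> prop_provable X S (PImp p q)"
| PImpE: "prop_provable X S (PImp p q) \<Longrightarrow> prop_provable X S p \<Longrightarrow> prop_provable X S q"
| PRAA: "symbols p \<subseteq> X \<Longrightarrow> prop_provable X (insert (PNeg p) S) PFalsum \<Longrightarrow> prop_provable X S p"

definition prop_consistent :: "'a set \<Rightarrow> 'a pfm set \<Rightarrow> bool" where
  "prop_consistent X S \<longleftrightarrow>
    \<not> (\<exists>p. symbols p \<subseteq> X \<and> prop_provable X S p \<and> prop_provable X S (PNeg p))"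


section \<open>The theories\<close>

definition DF_lang :: "bool \<Rightarrow> 'c set \<Rightarrow> (quant, 'c) lang" where
  "DF_lang eq C = \<lparr>rels = UNIV, arity = (\<lambda>_. 2), constants = C, has_eq = eq\<rparr>"

fun DF_sentence :: "'c basic \<Rightarrow> (quant, 'c) fm" where
  "DF_sentence (Basic Y a b) = Rel Y [Const a, Const b]"

text \<open>Under two quantifiers \<open>x\<close>, \<open>y\<close> are indices 1, 0; under three \<open>x\<close>, \<open>y\<close>, \<open>z\<close> are 2, 1, 0.\<close>

definition DF :: "(quant, 'c) fm set" where
  "DF = {
    All (All (Iff (Rel qE [Var 1, Var 0]) (Neg (Rel qI [Var 1, Var 0])))),
    All (All (Iff (Rel qO [Var 1, Var 0]) (Neg (Rel qA [Var 1, Var 0])))),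
    All (Rel qA [Var 0, Var 0]),
    All (All (Imp (Rel qA [Var 1, Var 0]) (Rel qI [Var 0, Var 1]))),
    All (All (Imp (Rel qE [Var 1, Var 0]) (Rel qE [Var 0, Var 1]))),
    All (All (All (Imp (And (Rel qA [Var 2, Var 1]) (Rel qA [Var 1, Var 0])) (Rel qA [Var 2, Var 0])))),
    All (All (All (Imp (And (Rel qA [Var 2, Var 1]) (Rel qE [Var 1, Var 0])) (Rel qE [Var 2, Var 0]))))}"

text \<open>The sentential symbols of \<open>SF J\<close> are the elements of \<open>BN J\<close>.\<close>

abbreviation SF_symb :: "quant \<Rightarrow> 'j \<Rightarrow> 'j \<Rightarrow> 'j basic pfm" where
  "SF_symb Y i j \<equiv> Symb (Basic Y i j)"

definition SF :: "'j set \<Rightarrow> 'j basic pfm set" where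
  "SF J =
    {PIff (SF_symb qE i j) (PNeg (SF_symb qI i j)) | i j. i \<in> J \<and> j \<in> J} \<union>
    {PIff (SF_symb qO i j) (PNeg (SF_symb qA i j)) | i j. i \<in> J \<and> j \<in> J} \<union>
    {SF_symb qA i i | i. i \<in> J} \<union>
    {PImp (SF_symb qA i j) (SF_symb qI j i) | i j. i \<in> J \<and> j \<in> J} \<union>
    {PImp (SF_symb qE i j) (SF_symb qE j i) | i j. i \<in> J \<and> j \<in> J} \<union>
    {PImp (PAnd (SF_symb qA i j) (SF_symb qA j k)) (SF_symb qA i k) | i j k. i \<in> J \<and> j \<in> J \<and> k \<in> J} \<union>
    {PImp (PAnd (SF_symb qA i j) (SF_symb qE j k)) (SF_symb qE i k) | i j k. i \<in> J \<and> j \<in> J \<and> k \<in> J}"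

text \<open>The language of \<open>MF P\<close> has no individual constants; \<open>unit\<close> only fills the type parameter.\<close>

definition MF_lang :: "bool \<Rightarrow> 'p set \<Rightarrow> ('p, unit) lang" where
  "MF_lang eq P = \<lparr>rels = P, arity = (\<lambda>_. 1), constants = {}, has_eq = eq\<rparr>"

fun MF_sentence :: "'p basic \<Rightarrow> ('p, unit) fm" where
  "MF_sentence (Basic qA p q) = All (Imp (Rel p [Var 0]) (Rel q [Var 0]))"
| "MF_sentence (Basic qE p q) = All (Imp (Rel p [Var 0]) (Neg (Rel q [Var 0])))"
| "MF_sentence (Basic qI p q) = Ex (And (Rel p [Var 0]) (Rel q [Var 0]))"
| "MF_sentence (Basic qO p q) = Ex (And (Rel p [Var 0]) (Neg (Rel q [Var 0])))"

definition MF :: "'p set \<Rightarrow> ('p, unit) fm set" where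
  "MF P = {Imp (MF_sentence (Basic qA p q)) (MF_sentence (Basic qI q p)) | p q. p \<in> P \<and> q \<in> P}"

end

theory Submission
  imports Defs
begin

text \<open>A d-consistent set has a set-theoretic model: take as points the pairs \<open>(a, b)\<close> with \<open>a = b\<close>
  or \<open>Iab \<in> \<Gamma>\<close>, and let \<open>c\<close> denote the set of those pairs one of whose components lies below \<open>c\<close> in
  the preorder generated by the \<open>A\<close>-sentences of \<open>\<Gamma>\<close>. Such an assignment of nonempty sets to terms
  gives a model of each of the three theories, so by soundness consistency and unprovability carry
  over from the syllogistic to the theories. Conversely, the d-rules are derivable in \<open>SF\<close>, and
  proofs in \<open>SF\<close> translate to \<open>DF\<close> and \<open>MF\<close> because the axioms of \<open>SF\<close> become theorems there.\<close>

section \<open>The syllogistic\<close>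

lemma Basic_in_BN [simp]: "Basic Y a b \<in> BN C \<longleftrightarrow> a \<in> C \<and> b \<in> C"
  by (auto simp: BN_def)

lemma contradictory_in_BN [simp]: "contradictory s \<in> BN C \<longleftrightarrow> s \<in> BN C"
  by (cases s rule: contradictory.cases) auto

lemma map_basic_contradictory: "map_basic f (contradictory s) = contradictory (map_basic f s)"
  by (cases s rule: contradictory.cases) auto

lemma map_basic_in_BN: "s \<in> BN C \<Longrightarrow> f ` C \<subseteq> D \<Longrightarrow> map_basic f s \<in> BN D"
  by (cases s) auto

text \<open>Rule induction for a derivability that is given by lists: course-of-values induction on
  positions, since the premises of a line stand before it.\<close>

lemma d_derives_induct [consumes 1, case_names Assm Rule]:
  assumes "d_derives C \<Gamma> s"
    and assm: "\<And>s. s \<in> \<Gamma> \<Longrightarrow> Q s"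
    and rule: "\<And>\<Pi> s. d_rule C \<Pi> s \<Longrightarrow> (\<And>p. p \<in> \<Pi> \<Longrightarrow> Q p) \<Longrightarrow> Q s"
  shows "Q s"
proof -
  from assms(1) obtain ss where ss: "ss \<noteq> []" "last ss = s"
    and step: "\<And>i. i < length ss \<Longrightarrow>
      ss ! i \<in> \<Gamma> \<or> (\<exists>\<Pi>. d_rule C \<Pi> (ss ! i) \<and> \<Pi> \<subseteq> set (take i ss))"
    unfolding d_derives_def by blast
  have "i < length ss \<longrightarrow> Q (ss ! i)" for i
  proof (induction i rule: less_induct)
    case (less i)
    show ?case
    proof
      assume i: "i < length ss"
      show "Q (ss ! i)"
      proof (cases "ss ! i \<in> \<Gamma>")
        case False
        then obtain \<Pi> where \<Pi>: "d_rule C \<Pi> (ss ! i)" "\<Pi> \<subseteq> set (take i ss)"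
          using step[OF i] by blast
        have "Q p" if "p \<in> \<Pi>" for p
        proof -
          from that \<Pi>(2) obtain j where "j < i" "p = ss ! j"
            using i by (fastforce simp: in_set_conv_nth)
          then show ?thesis using less i by simp
        qed
        then show ?thesis using rule \<Pi>(1) by blast
      qed (rule assm)
    qed
  qed
  from this[of "length ss - 1"] show ?thesis
    using ss by (simp add: last_conv_nth)
qed

text \<open>Unlike in \<open>d_derives\<close>, the empty list is allowed and no last line is
  prescribed, so that derivations of several premises can be concatenated, starting from
  \<open>[]\<close>.\<close>

definition derivation :: "'c set \<Rightarrow> 'c basic set \<Rightarrow> 'c basic list \<Rightarrow> bool" where
  "derivation C \<Gamma> ss \<longleftrightarrow> set ss \<subseteq> BN C \<and>
    (\<forall>i<length ss. ss ! i \<in> \<Gamma> \<or> (\<exists>\<Pi>. d_rule C \<Pi> (ss ! i) \<and> \<Pi> \<subseteq> set (take i ss)))"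

lemma d_derives_iff_derivation:
  "d_derives C \<Gamma> s \<longleftrightarrow> (\<exists>ss. ss \<noteq> [] \<and> derivation C \<Gamma> ss \<and> last ss = s)"
  unfolding d_derives_def derivation_def by blast

lemma derivation_append:
  assumes "derivation C \<Gamma> ss" and "derivation C \<Gamma> ts"
  shows "derivation C \<Gamma> (ss @ ts)"
  unfolding derivation_def
proof (intro conjI allI impI)
  show "set (ss @ ts) \<subseteq> BN C" using assms by (auto simp: derivation_def)
next
  fix i assume i: "i < length (ss @ ts)"
  show "(ss @ ts) ! i \<in> \<Gamma> \<or>
      (\<exists>\<Pi>. d_rule C \<Pi> ((ss @ ts) ! i) \<and> \<Pi> \<subseteq> set (take i (ss @ ts)))"
  proof (cases "i < length ss")
    case True
    then show ?thesis using assms(1) by (auto simp: derivation_def nth_append)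
  next
    case False
    then have "i - length ss < length ts" using i by auto
    then have "ts ! (i - length ss) \<in> \<Gamma> \<or>
      (\<exists>\<Pi>. d_rule C \<Pi> (ts ! (i - length ss)) \<and> \<Pi> \<subseteq> set (take (i - length ss) ts))"
      using assms(2) unfolding derivation_def by blast
    then show ?thesis using False by (auto simp: nth_append)
  qed
qed

lemma derivation_snoc:
  assumes "derivation C \<Gamma> ss" and "s \<in> BN C"
    and "s \<in> \<Gamma> \<or> (\<exists>\<Pi>. d_rule C \<Pi> s \<and> \<Pi> \<subseteq> set ss)"
  shows "derivation C \<Gamma> (ss @ [s])"
  using assms by (auto simp: derivation_def nth_append less_Suc_eq)

lemma d_derives_assm: "s \<in> \<Gamma> \<Longrightarrow> s \<in> BN C \<Longrightarrow> d_derives C \<Gamma> s"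
  unfolding d_derives_iff_derivation
  by (rule exI[of _ "[s]"]) (simp add: derivation_def)

lemma d_rule_in_BN: "d_rule C \<Pi> s \<Longrightarrow> s \<in> BN C"
  by (induction rule: d_rule.induct) auto

lemma d_rule_finite: "d_rule C \<Pi> s \<Longrightarrow> finite \<Pi>"
  by (induction rule: d_rule.induct) auto

text \<open>A rule has finitely many premises; their derivations are joined into one list, to which
  the conclusion is appended.\<close>

lemma d_derives_rule:
  assumes "d_rule C \<Pi> s" and "\<And>p. p \<in> \<Pi> \<Longrightarrow> d_derives C \<Gamma> p"
  shows "d_derives C \<Gamma> s"
proof -
  have "finite \<Pi>" using assms(1) by (rule d_rule_finite)
  from this assms(2) have "\<exists>ss. derivation C \<Gamma> ss \<and> \<Pi> \<subseteq> set ss"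
  proof (induction \<Pi> rule: finite_induct)
    case empty
    show ?case by (rule exI[of _ "[]"]) (simp add: derivation_def)
  next
    case (insert p \<Pi>)
    then obtain ss where ss: "derivation C \<Gamma> ss" "\<Pi> \<subseteq> set ss" by auto
    from insert.prems[of p] obtain ts where "ts \<noteq> []" "derivation C \<Gamma> ts" "last ts = p"
      by (auto simp: d_derives_iff_derivation)
    then show ?case
      using ss by (intro exI[of _ "ss @ ts"]) (auto intro: derivation_append)
  qed
  then obtain ss where "derivation C \<Gamma> ss" "\<Pi> \<subseteq> set ss" by blast
  then have "derivation C \<Gamma> (ss @ [s])"
    using assms(1) by (blast intro: derivation_snoc d_rule_in_BN)
  then show ?thesis unfolding d_derives_iff_derivation by (intro exI[of _ "ss @ [s]"]) simp
qed

section \<open>Set-valued models of the syllogistic\<close>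

fun holds :: "('c \<Rightarrow> 'd set) \<Rightarrow> 'c basic \<Rightarrow> bool" where
  "holds V (Basic qA a b) \<longleftrightarrow> V a \<subseteq> V b"
| "holds V (Basic qE a b) \<longleftrightarrow> V a \<inter> V b = {}"
| "holds V (Basic qI a b) \<longleftrightarrow> V a \<inter> V b \<noteq> {}"
| "holds V (Basic qO a b) \<longleftrightarrow> \<not> V a \<subseteq> V b"

lemma holds_contradictory [simp]: "holds V (contradictory s) \<longleftrightarrow> \<not> holds V s"
  by (cases s rule: contradictory.cases) auto

text \<open>Each point is a witness: \<open>(a, a)\<close> keeps \<open>V a\<close> nonempty and
  refutes \<open>Aab\<close> when \<open>Oab\<close> is in \<open>\<Gamma>\<close>, while
  \<open>(a, b)\<close> verifies \<open>Iab\<close>. The \<open>A\<close>-sentences hold because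
  \<open>le\<close> is transitive, and a violated \<open>E\<close>-sentence would make
  \<open>\<Gamma>\<close> inconsistent. Nonemptiness is obtained for every element of the type, also
  outside \<open>C\<close>.\<close>

lemma d_consistent_model:
  fixes C :: "'c set"
  assumes con: "d_consistent C \<Gamma>" and BN: "\<Gamma> \<subseteq> BN C"
  obtains V :: "'c \<Rightarrow> ('c \<times> 'c) set"
  where "\<And>a. V a \<noteq> {}" and "\<And>s. s \<in> \<Gamma> \<Longrightarrow> holds V s"
proof -
  define le where "le = {(a, b). Basic qA a b \<in> \<Gamma>}\<^sup>*"
  define V where
    "V c = {(a, b). (a = b \<or> Basic qI a b \<in> \<Gamma>) \<and> ((a, c) \<in> le \<or> (b, c) \<in> le)}" for c
  have Id: "d_derives C \<Gamma> (Basic qA a a)" if "a \<in> C" for a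
    using that by (auto intro: d_derives_rule d_rule.A_Id)
  have Bar: "d_derives C \<Gamma> (Basic qA a c)"
    if "d_derives C \<Gamma> (Basic qA a b)" "d_derives C \<Gamma> (Basic qA b c)"
      "a \<in> C" "b \<in> C" "c \<in> C" for a b c
    by (rule d_derives_rule[OF d_rule.Barbara[of a C b c]]) (use that in auto)
  have Cel: "d_derives C \<Gamma> (Basic qE a c)"
    if "d_derives C \<Gamma> (Basic qA a b)" "d_derives C \<Gamma> (Basic qE b c)"
      "a \<in> C" "b \<in> C" "c \<in> C" for a b c
    by (rule d_derives_rule[OF d_rule.Celarent[of a C b c]]) (use that in auto)
  have Ec: "d_derives C \<Gamma> (Basic qE b a)"
    if "d_derives C \<Gamma> (Basic qE a b)" "a \<in> C" "b \<in> C" for a b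
    by (rule d_derives_rule[OF d_rule.Ec[of a C b]]) (use that in auto)
  have Irefl: "d_derives C \<Gamma> (Basic qI a a)" if "a \<in> C" for a
    by (rule d_derives_rule[OF d_rule.Apc[of a C a]]) (use that Id in auto)
  \<comment> \<open>Barbara condenses a chain of \<open>A\<close>-sentences of
    \<open>\<Gamma>\<close> into one. In the empty chain \<open>a = b\<close>, so
    \<open>b \<in> C\<close> yields \<open>a \<in> C\<close>.\<close>
  have le_C: "a \<in> C \<and> d_derives C \<Gamma> (Basic qA a b)" if "(a, b) \<in> le" "b \<in> C" for a b
    using that(1) unfolding le_def
  proof (induction rule: converse_rtrancl_induct)
    case base
    then show ?case using Id \<open>b \<in> C\<close> by simp
  next
    case (step a a')
    then have "Basic qA a a' \<in> \<Gamma>" "a \<in> C" using BN by auto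
    then have "d_derives C \<Gamma> (Basic qA a a')" using step by (simp add: d_derives_assm)
    then show ?case
      using step \<open>a \<in> C\<close> \<open>b \<in> C\<close> Bar by blast
  qed
  have noE: False if "d_derives C \<Gamma> (Basic qE a b)" "d_derives C \<Gamma> (Basic qI a b)"
    "a \<in> C" "b \<in> C" for a b
    using con that by (auto simp: d_inconsistent_def dest!: bspec[of _ _ "Basic qE a b"])
  \<comment> \<open>A point shared by \<open>V c\<close> and \<open>V d\<close> has a component
    below \<open>c\<close> and one below \<open>d\<close>, possibly the same one or in swapped
    order; hence the three alternatives. \<open>Celarent\<close> and \<open>Ec\<close> pull
    \<open>Ecd\<close> down to \<open>Eab\<close> and \<open>Eba\<close>, against
    \<open>Iaa\<close>, \<open>Iab\<close> or \<open>Iba\<close>.\<close>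
  have disj: False
    if "Basic qE c d \<in> \<Gamma>" "(a, c) \<in> le" "(b, d) \<in> le"
      "a = b \<or> Basic qI a b \<in> \<Gamma> \<or> Basic qI b a \<in> \<Gamma>" for a b c d
  proof -
    have C: "c \<in> C" "d \<in> C" using that BN by auto
    then have ab: "a \<in> C" "b \<in> C" using that le_C by auto
    have "d_derives C \<Gamma> (Basic qE c d)" using that C by (auto intro: d_derives_assm)
    then have "d_derives C \<Gamma> (Basic qE a b)"
      using Cel Ec C ab le_C[OF that(2)] le_C[OF that(3)] by blast
    then have *: "d_derives C \<Gamma> (Basic qE a b)" "d_derives C \<Gamma> (Basic qE b a)"
      using Ec ab by auto
    show False
      using that(4)
    proof
      assume "a = b"
      then show False using * Irefl noE ab by blast
    next
      assume "Basic qI a b \<in> \<Gamma> \<or> Basic qI b a \<in> \<Gamma>"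
      then have "d_derives C \<Gamma> (Basic qI a b) \<or> d_derives C \<Gamma> (Basic qI b a)"
        using ab by (auto intro: d_derives_assm)
      then show False using * noE ab by blast
    qed
  qed
  show thesis
  proof
    show "V a \<noteq> {}" for a
      using rtrancl_refl by (auto simp: V_def le_def)
  next
    fix s assume s: "s \<in> \<Gamma>"
    show "holds V s"
    proof (cases s rule: contradictory.cases)
      case (1 a b)
      then have "(a, b) \<in> le" using s by (auto simp: le_def)
      then show ?thesis using 1 unfolding V_def le_def by (auto intro: rtrancl_trans)
    next
      case (2 a b)
      have "(a, a) \<in> V a" using 2 by (auto simp: V_def le_def)
      \<comment> \<open>Both components are \<open>a\<close>, so membership would mean that
        \<open>a\<close> lies below \<open>b\<close>, and \<open>Aab\<close> would be
        derivable.\<close>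
      moreover have "(a, a) \<notin> V b"
      proof
        assume "(a, a) \<in> V b"
        then have "d_derives C \<Gamma> (Basic qA a b)" "a \<in> C" "b \<in> C"
          using 2 s BN le_C by (auto simp: V_def)
        moreover have "d_derives C \<Gamma> (Basic qO a b)" using 2 s BN by (auto intro: d_derives_assm)
        ultimately show False
          using con by (auto simp: d_inconsistent_def dest!: bspec[of _ _ "Basic qA a b"])
      qed
      ultimately show ?thesis using 2 by auto
    next
      case (3 a b)
      then show ?thesis using s disj by (fastforce simp: V_def)
    next
      case (4 a b)
      then have "(a, b) \<in> V a \<inter> V b" using s by (auto simp: V_def le_def)
      then show ?thesis using 4 by auto
    qed
  qed
qed

text \<open>\<open>SF\<close> and \<open>MF\<close> speak of renamed terms, so the model is carried
  over to the type of the new terms.\<close>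

lemma d_consistent_model_map:
  fixes C :: "'c set" and f :: "'c \<Rightarrow> 'j"
  assumes "d_consistent C \<Gamma>" and "\<Gamma> \<subseteq> BN C" and "inj_on f C"
  obtains V :: "'j \<Rightarrow> ('c \<times> 'c) set"
  where "\<And>a. V a \<noteq> {}" and "\<And>t. t \<in> map_basic f ` \<Gamma> \<Longrightarrow> holds V t"
proof -
  obtain V :: "'c \<Rightarrow> ('c \<times> 'c) set" where V: "\<And>a. V a \<noteq> {}" "\<And>s. s \<in> \<Gamma> \<Longrightarrow> holds V s"
    using d_consistent_model[OF assms(1,2)] by blast
  \<comment> \<open>\<open>inv_into C f\<close> undoes \<open>f\<close> on \<open>C\<close>; at
    arguments outside the image of \<open>C\<close> its value is unspecified, but \<open>V\<close>
    is nonempty at any value.\<close>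
  define W where "W = V \<circ> inv_into C f"
  have "holds W (map_basic f s) \<longleftrightarrow> holds V s" if "s \<in> BN C" for s
    using that assms(3) by (cases "(V, s)" rule: holds.cases) (auto simp: W_def)
  then have "holds W t" if "t \<in> map_basic f ` \<Gamma>" for t
    using that V assms(2) by auto
  then show thesis
    using that[of W] V by (simp add: W_def)
qed

section \<open>Soundness of the propositional and the first order calculus\<close>

fun peval :: "('a \<Rightarrow> bool) \<Rightarrow> 'a pfm \<Rightarrow> bool" where
  "peval v (Symb x) \<longleftrightarrow> v x"
| "peval v PFalsum \<longleftrightarrow> False"
| "peval v (PImp p q) \<longleftrightarrow> (peval v p \<longrightarrow> peval v q)"

lemma prop_soundness:
  "prop_provable X S p \<Longrightarrow> (\<And>q. q \<in> S \<Longrightarrow> peval v q) \<Longrightarrow> peval v p"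
proof (induction rule: prop_provable.induct)
  case (PRAA p S)
  then show ?case by (metis insert_iff peval.simps(2,3))
qed auto

text \<open>The semantic counterpart of both \<open>lift_fm n\<close>, which skips index
  \<open>n\<close>, and \<open>subst_fm n\<close>, which eliminates it; with \<open>n = 0\<close> it
  interprets a quantifier.\<close>

definition env_insert :: "nat \<Rightarrow> 'd \<Rightarrow> (nat \<Rightarrow> 'd) \<Rightarrow> nat \<Rightarrow> 'd" where
  "env_insert n d e i = (if i < n then e i else if i = n then d else e (i - 1))"

lemma env_insert_0_0 [simp]: "env_insert 0 d e 0 = d"
  and env_insert_0_Suc [simp]: "env_insert 0 d e (Suc i) = e i"
  by (simp_all add: env_insert_def)

fun tm_val :: "('k \<Rightarrow> 'd) \<Rightarrow> (nat \<Rightarrow> 'd) \<Rightarrow> 'k tm \<Rightarrow> 'd" where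
  "tm_val c e (Var i) = e i"
| "tm_val c e (Const k) = c k"

text \<open>The domain is the whole type of points, hence never empty, and \<open>Eq\<close> is
  identity, so that one soundness proof serves languages with and without equality.\<close>

fun sat :: "('r \<Rightarrow> 'd list \<Rightarrow> bool) \<Rightarrow> ('k \<Rightarrow> 'd) \<Rightarrow> (nat \<Rightarrow> 'd) \<Rightarrow> ('r, 'k) fm \<Rightarrow> bool" where
  "sat R c e (Rel r ts) \<longleftrightarrow> R r (map (tm_val c e) ts)"
| "sat R c e (Eq s t) \<longleftrightarrow> tm_val c e s = tm_val c e t"
| "sat R c e Falsum \<longleftrightarrow> False"
| "sat R c e (Imp p q) \<longleftrightarrow> (sat R c e p \<longrightarrow> sat R c e q)"
| "sat R c e (All p) \<longleftrightarrow> (\<forall>d. sat R c (env_insert 0 d e) p)"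

text \<open>Passing under a quantifier shifts the place of an earlier insertion by one; this is the
  \<open>All\<close> case of the lemmas on lifting and substitution.\<close>

lemma env_insert_0_env_insert:
  "env_insert 0 d (env_insert n d' e) = env_insert (Suc n) d' (env_insert 0 d e)"
  by (auto simp: env_insert_def fun_eq_iff)

lemma tm_val_lift [simp]: "tm_val c (env_insert n d e) (lift_tm n t) = tm_val c e t"
  by (cases t) (auto simp: env_insert_def)

lemma sat_lift [simp]: "sat R c (env_insert n d e) (lift_fm n p) \<longleftrightarrow> sat R c e p"
  by (induction p arbitrary: n e) (simp_all add: env_insert_0_env_insert comp_def)

lemma tm_val_subst: "tm_val c e (subst_tm n u t) = tm_val c (env_insert n (tm_val c e u) e) t"
  by (cases t) (auto simp: env_insert_def)

lemma sat_subst: "sat R c e (subst_fm n u p) \<longleftrightarrow> sat R c (env_insert n (tm_val c e u) e) p"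
  by (induction p arbitrary: n u e) (simp_all add: env_insert_0_env_insert tm_val_subst comp_def)

text \<open>The environment has to vary in the induction, because \<open>AllI\<close> evaluates its
  premise at all values of index 0.\<close>

lemma fo_soundness:
  "fo_provable L S p \<Longrightarrow> (\<And>q. q \<in> S \<Longrightarrow> sat R c e q) \<Longrightarrow> sat R c e p"
proof (induction arbitrary: e rule: fo_provable.induct)
  case (ImpI p S q)
  then show ?case by auto
next
  case (RAA p S)
  then show ?case by (metis insert_iff sat.simps(3,4))
next
  case (AllI S p)
  \<comment> \<open>The lifted assumptions do not mention index 0, so they stay true whatever
    \<open>d\<close> is.\<close>
  have "sat R c (env_insert 0 d e) p" for d
    using AllI.prems by (intro AllI.IH) auto
  then show ?case by simp
qed (auto simp: sat_subst)

section \<open>Provability\<close>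

lemma prop_provable_mono: "prop_provable X S p \<Longrightarrow> S \<subseteq> T \<Longrightarrow> prop_provable X T p"
proof (induction arbitrary: T rule: prop_provable.induct)
  case (PImpI p S q)
  then show ?case by (meson insert_mono prop_provable.PImpI)
next
  case (PRAA p S)
  then show ?case by (meson insert_mono prop_provable.PRAA)
qed (auto intro: prop_provable.intros)

lemma fo_provable_mono: "fo_provable L S p \<Longrightarrow> S \<subseteq> T \<Longrightarrow> fo_provable L T p"
proof (induction arbitrary: T rule: fo_provable.induct)
  case (ImpI p S q)
  then show ?case by (meson insert_mono fo_provable.ImpI)
next
  case (RAA p S)
  then show ?case by (meson insert_mono fo_provable.RAA)
next
  case (AllI S p)
  then show ?case by (meson image_mono fo_provable.AllI)
qed (auto intro: fo_provable.intros)

text \<open>\<open>PImp PFalsum PFalsum\<close> is provable outright, so a provable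
  \<open>PFalsum\<close> comes with its own negation.\<close>

lemma prop_consistent_iff: "prop_consistent X S \<longleftrightarrow> \<not> prop_provable X S PFalsum"
proof
  assume "prop_consistent X S"
  then show "\<not> prop_provable X S PFalsum"
    using PImpI[of PFalsum X S PFalsum] PAssm[of PFalsum "insert PFalsum S" X]
    unfolding prop_consistent_def by auto
qed (auto simp: prop_consistent_def intro: PImpE)

lemma fo_consistent_iff: "fo_consistent L S \<longleftrightarrow> \<not> fo_provable L S Falsum"
proof
  assume "fo_consistent L S"
  then show "\<not> fo_provable L S Falsum"
    using ImpI[of L Falsum S Falsum] Assm[of Falsum "insert Falsum S" L]
    unfolding fo_consistent_def by auto
qed (auto simp: fo_consistent_def intro: ImpE)

section \<open>Translation of sentential proofs into first order proofs\<close>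

fun interp :: "('a \<Rightarrow> ('r, 'k) fm) \<Rightarrow> 'a pfm \<Rightarrow> ('r, 'k) fm" where
  "interp f (Symb x) = f x"
| "interp f PFalsum = Falsum"
| "interp f (PImp p q) = Imp (interp f p) (interp f q)"

lemma fm_in_interp: "symbols p \<subseteq> X \<Longrightarrow> (\<And>x. x \<in> X \<Longrightarrow> fm_in L (f x)) \<Longrightarrow> fm_in L (interp f p)"
  by (induction p) auto

text \<open>The sentential rules are matched one for one by first order rules, and the connectives
  of both calculi are defined alike from implication and falsum. Members of \<open>S\<close> are to
  become provable from \<open>T\<close> rather than members of it, so axioms of \<open>SF\<close>
  may turn into theorems. \<open>T\<close> varies, because discharged formulas are added to
  it.\<close>

lemma fo_provable_interp:
  assumes "prop_provable X S p" and "\<And>x. x \<in> X \<Longrightarrow> fm_in L (f x)"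
    and "\<And>q. q \<in> S \<Longrightarrow> fo_provable L T (interp f q)"
  shows "fo_provable L T (interp f p)"
  using assms(1,3)
proof (induction arbitrary: T rule: prop_provable.induct)
  case (PAssm p S)
  then show ?case by simp
next
  case (PImpI p S q)
  have p: "fm_in L (interp f p)" using PImpI.hyps(1) assms(2) by (rule fm_in_interp)
  then have "fo_provable L (insert (interp f p) T) (interp f q)"
    using PImpI.prems by (intro PImpI.IH) (auto intro: Assm fo_provable_mono)
  then show ?case using p by (simp add: ImpI)
next
  case (PImpE S p q)
  then show ?case by (auto intro: ImpE)
next
  case (PRAA p S)
  have p: "fm_in L (interp f p)" using PRAA.hyps(1) assms(2) by (rule fm_in_interp)
  then have "fo_provable L (insert (Neg (interp f p)) T) (interp f PFalsum)"
    using PRAA.prems by (intro PRAA.IH) (auto intro: Assm fo_provable_mono)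
  then show ?case using p by (simp add: RAA)
qed

section \<open>Syllogistic derivations in the sentential theory\<close>

text \<open>Recovers from a provable formula the side conditions on \<open>symbols\<close> that the
  discharging rules ask for.\<close>

lemma prop_provable_symbols: "prop_provable X S p \<Longrightarrow> symbols p \<subseteq> X"
  by (induction rule: prop_provable.induct) auto

lemma prop_provable_insert: "prop_provable X S p \<Longrightarrow> prop_provable X (insert q S) p"
  by (erule prop_provable_mono) auto

lemma prop_provable_AndI:
  assumes "prop_provable X S p" and "prop_provable X S q"
  shows "prop_provable X S (PAnd p q)"
proof -
  let ?T = "insert (PImp p (PNeg q)) S"
  have sy: "symbols (PImp p (PNeg q)) \<subseteq> X" using assms prop_provable_symbols by fastforce
  then have "prop_provable X ?T (PImp p (PNeg q))" by (intro PAssm) auto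
  then have "prop_provable X ?T PFalsum"
    using assms by (meson PImpE prop_provable_insert)
  then show ?thesis by (rule PImpI[rotated]) (use sy in auto)
qed

lemma prop_provable_AndD1:
  assumes "prop_provable X S (PAnd p q)"
  shows "prop_provable X S p"
proof -
  let ?T = "insert (PNeg p) S"
  have sy: "symbols p \<subseteq> X" "symbols q \<subseteq> X" using assms prop_provable_symbols by fastforce+
  \<comment> \<open>Ex falso: with \<open>p\<close> and \<open>PNeg p\<close> assumed, any formula
    follows; here it is \<open>PNeg q\<close>, whose negation is the assumption that
    \<open>PRAA\<close> discharges.\<close>
  have "prop_provable X (insert (PNeg (PNeg q)) (insert p ?T)) PFalsum"
    by (rule PImpE[of X _ p PFalsum]; rule PAssm) (use sy in auto)
  then have "prop_provable X ?T (PImp p (PNeg q))"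
    using sy by (intro PImpI[OF _ PRAA]) auto
  then have "prop_provable X ?T PFalsum" using assms by (meson PImpE prop_provable_insert)
  then show ?thesis by (rule PRAA[rotated]) (use sy in auto)
qed

lemma prop_provable_AndD2:
  assumes "prop_provable X S (PAnd p q)"
  shows "prop_provable X S q"
proof -
  let ?T = "insert (PNeg q) S"
  have sy: "symbols p \<subseteq> X" "symbols q \<subseteq> X" using assms prop_provable_symbols by fastforce+
  then have "prop_provable X ?T (PImp p (PNeg q))"
    by (intro PImpI PAssm) auto
  then have "prop_provable X ?T PFalsum" using assms by (meson PImpE prop_provable_insert)
  then show ?thesis by (rule PRAA[rotated]) (use sy in auto)
qed

lemma SF_symbols: "q \<in> SF J \<Longrightarrow> symbols q \<subseteq> BN J"
  by (auto simp: SF_def)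

lemma SF_provable: "q \<in> SF J \<Longrightarrow> SF J \<subseteq> S \<Longrightarrow> prop_provable (BN J) S q"
  by (auto intro: PAssm dest: SF_symbols)

text \<open>Each d-rule is the rule form of an axiom of \<open>SF\<close>; two premises are first
  joined by \<open>PAnd\<close>.\<close>

lemma d_rule_SF_provable:
  assumes "d_rule C \<Pi> s" and "f ` C \<subseteq> J" and S: "SF J \<subseteq> S"
    and "\<And>p. p \<in> \<Pi> \<Longrightarrow> prop_provable (BN J) S (Symb (map_basic f p))"
  shows "prop_provable (BN J) S (Symb (map_basic f s))"
  using assms(1,2,4)
proof (induction rule: d_rule.induct)
  case (A_Id a)
  then have "SF_symb qA (f a) (f a) \<in> SF J" by (auto simp: SF_def)
  then show ?case using S by (simp add: SF_provable)
next
  case (Apc a b)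
  then have "PImp (SF_symb qA (f a) (f b)) (SF_symb qI (f b) (f a)) \<in> SF J"
    by (auto simp: SF_def)
  then show ?case using S Apc.prems by (auto intro: PImpE SF_provable)
next
  case (Ec a b)
  then have "PImp (SF_symb qE (f a) (f b)) (SF_symb qE (f b) (f a)) \<in> SF J"
    by (auto simp: SF_def)
  then show ?case using S Ec.prems by (auto intro: PImpE SF_provable)
next
  case (Barbara a b c)
  then have "PImp (PAnd (SF_symb qA (f a) (f b)) (SF_symb qA (f b) (f c)))
      (SF_symb qA (f a) (f c)) \<in> SF J"
    by (auto simp: SF_def)
  then have "prop_provable (BN J) S (PImp (PAnd (SF_symb qA (f a) (f b)) (SF_symb qA (f b) (f c)))
      (SF_symb qA (f a) (f c)))"
    using S by (rule SF_provable)
  then have "prop_provable (BN J) S (SF_symb qA (f a) (f c))"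
    using Barbara.prems(2)[of "Basic qA a b"] Barbara.prems(2)[of "Basic qA b c"]
    by (auto elim: PImpE intro: prop_provable_AndI)
  then show ?case by simp
next
  case (Celarent a b c)
  then have "PImp (PAnd (SF_symb qA (f a) (f b)) (SF_symb qE (f b) (f c)))
      (SF_symb qE (f a) (f c)) \<in> SF J"
    by (auto simp: SF_def)
  then have "prop_provable (BN J) S (PImp (PAnd (SF_symb qA (f a) (f b)) (SF_symb qE (f b) (f c)))
      (SF_symb qE (f a) (f c)))"
    using S by (rule SF_provable)
  then have "prop_provable (BN J) S (SF_symb qE (f a) (f c))"
    using Celarent.prems(2)[of "Basic qA a b"] Celarent.prems(2)[of "Basic qE b c"]
    by (auto elim: PImpE intro: prop_provable_AndI)
  then show ?case by simp
qed

text \<open>The axioms present \<open>E\<close> and \<open>O\<close> as negations of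
  \<open>I\<close> and \<open>A\<close>, so which of the two forms is available depends on the
  quantifier of \<open>s\<close>.\<close>

lemma SF_contradictory_cases:
  assumes "s \<in> BN J" and S: "SF J \<subseteq> S"
  obtains
    "prop_provable (BN J) S (PIff (Symb s) (PNeg (Symb (contradictory s))))"
  | "prop_provable (BN J) S (PIff (Symb (contradictory s)) (PNeg (Symb s)))"
proof -
  have "PIff (Symb s) (PNeg (Symb (contradictory s))) \<in> SF J \<or>
      PIff (Symb (contradictory s)) (PNeg (Symb s)) \<in> SF J"
    using assms(1) by (cases s rule: contradictory.cases) (auto simp: SF_def)
  then show thesis using that SF_provable S by blast
qed

lemma SF_contradiction:
  assumes s: "s \<in> BN J" and S: "SF J \<subseteq> S"
    and "prop_provable (BN J) S (Symb s)"
    and "prop_provable (BN J) S (Symb (contradictory s))"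
  shows "prop_provable (BN J) S PFalsum"
  using s S by (rule SF_contradictory_cases) (meson assms(3,4) PImpE prop_provable_AndD1)+

text \<open>The sentential form of the indirect proof in \<open>g_derives\<close>. When
  \<open>s\<close> is an \<open>E\<close>- or \<open>O\<close>-sentence, its axiom gives
  \<open>s\<close> directly; for \<open>A\<close> and \<open>I\<close> a classical reductio
  follows.\<close>

lemma SF_reductio:
  assumes s: "s \<in> BN J" and S: "SF J \<subseteq> S"
    and F: "prop_provable (BN J) (insert (Symb (contradictory s)) S) PFalsum"
  shows "prop_provable (BN J) S (Symb s)"
  using s S
proof (rule SF_contradictory_cases)
  assume "prop_provable (BN J) S (PIff (Symb s) (PNeg (Symb (contradictory s))))"
  moreover have "prop_provable (BN J) S (PNeg (Symb (contradictory s)))"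
    using F by (rule PImpI[rotated]) (use s in auto)
  ultimately show ?thesis by (meson PImpE prop_provable_AndD2)
next
  let ?T = "insert (PNeg (Symb s)) S"
  assume "prop_provable (BN J) S (PIff (Symb (contradictory s)) (PNeg (Symb s)))"
  then have "prop_provable (BN J) ?T (PImp (PNeg (Symb s)) (Symb (contradictory s)))"
    by (meson prop_provable_insert prop_provable_AndD2)
  moreover have "prop_provable (BN J) ?T (PNeg (Symb s))"
    using s by (intro PAssm) auto
  moreover have "prop_provable (BN J) S (PNeg (Symb (contradictory s)))"
    using F by (rule PImpI[rotated]) (use s in auto)
  ultimately have "prop_provable (BN J) ?T PFalsum" by (meson PImpE prop_provable_insert)
  then show ?thesis by (rule PRAA[rotated]) (use s in auto)
qed

lemma d_derives_SF:
  assumes "d_derives C \<Gamma> s" and "\<Gamma> \<subseteq> BN C" and "f ` C \<subseteq> J"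
  shows "prop_provable (BN J) (Symb ` map_basic f ` \<Gamma> \<union> SF J) (Symb (map_basic f s))"
  using assms(1)
proof (induction rule: d_derives_induct)
  case (Assm s)
  then have "map_basic f s \<in> BN J" using assms by (blast intro: map_basic_in_BN)
  then show ?case using Assm by (intro PAssm) auto
next
  case (Rule \<Pi> s)
  then show ?case using assms(3) by (blast intro: d_rule_SF_provable)
qed

lemma d_inconsistent_SF:
  assumes "d_inconsistent C \<Gamma>" and "\<Gamma> \<subseteq> BN C" and "f ` C \<subseteq> J"
  shows "prop_provable (BN J) (Symb ` map_basic f ` \<Gamma> \<union> SF J) PFalsum"
proof -
  from assms(1) obtain s where "s \<in> BN C" "d_derives C \<Gamma> s" "d_derives C \<Gamma> (contradictory s)"
    unfolding d_inconsistent_def by blast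
  then show ?thesis
    using assms(2,3)
    by (intro SF_contradiction[of "map_basic f s"])
      (auto intro: map_basic_in_BN d_derives_SF simp flip: map_basic_contradictory)
qed

lemma g_derives_SF:
  assumes "g_derives C \<Gamma> s" and "\<Gamma> \<union> {s} \<subseteq> BN C" and "f ` C \<subseteq> J"
  shows "prop_provable (BN J) (Symb ` map_basic f ` \<Gamma> \<union> SF J) (Symb (map_basic f s))"
proof (rule SF_reductio)
  have "prop_provable (BN J) (Symb ` map_basic f ` (\<Gamma> \<union> {contradictory s}) \<union> SF J) PFalsum"
    using assms by (intro d_inconsistent_SF) (auto simp: g_derives_def)
  then show "prop_provable (BN J)
      (insert (Symb (contradictory (map_basic f s))) (Symb ` map_basic f ` \<Gamma> \<union> SF J)) PFalsum"
    by (simp add: map_basic_contradictory)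
qed (use assms in \<open>auto intro: map_basic_in_BN\<close>)

section \<open>The sentential theory in the first order theories\<close>

text \<open>The outer variable is instantiated first, while the inner quantifier is still present;
  hence index 1 and the lifted term.\<close>

lemma fo_provable_AllE2:
  assumes "fo_provable L S (All (All p))" and "tm_in L t" and "tm_in L u"
  shows "fo_provable L S (subst_fm 0 u (subst_fm 1 (lift_tm 0 t) p))"
  using AllE[OF AllE[OF assms(1,2), unfolded subst_fm.simps] assms(3)] by simp

lemma fo_provable_AllE3:
  assumes "fo_provable L S (All (All (All p)))" and "tm_in L t" and "tm_in L u" and "tm_in L v"
  shows "fo_provable L S
    (subst_fm 0 v (subst_fm 1 (lift_tm 0 u) (subst_fm 2 (lift_tm 0 (lift_tm 0 t)) p)))"
  using AllE[OF fo_provable_AllE2[OF assms(1-3), unfolded subst_fm.simps] assms(4)]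
  by (simp add: numeral_2_eq_2)

lemma DF_in_lang: "p \<in> DF \<Longrightarrow> fm_in (DF_lang eq C) p"
  by (auto simp: DF_def DF_lang_def)

lemma DF_sentence_in_lang: "s \<in> BN C \<Longrightarrow> fm_in (DF_lang eq C) (DF_sentence s)"
  by (cases s) (auto simp: DF_lang_def)

text \<open>The axioms of \<open>SF\<close> are instances at constants of the axioms of
  \<open>DF\<close>.\<close>

lemma DF_proves_SF:
  assumes "q \<in> SF C" and "DF \<subseteq> S"
  shows "fo_provable (DF_lang eq C) S (interp DF_sentence q)"
proof -
  let ?L = "DF_lang eq C"
  have ax: "fo_provable ?L S p" if "p \<in> DF" for p
    using that assms(2) by (blast intro: Assm DF_in_lang)
  have c: "tm_in ?L (Const a)" if "a \<in> C" for a using that by (simp add: DF_lang_def)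
  \<comment> \<open>Picks the seven axioms one by one out of the set literal, in the order of its
    elements.\<close>
  note ax1 = ax[unfolded DF_def, OF insertI1]
   and ax2 = ax[unfolded DF_def, OF insertI2, OF insertI1]
   and ax3 = ax[unfolded DF_def, OF insertI2, OF insertI2, OF insertI1]
   and ax4 = ax[unfolded DF_def, OF insertI2, OF insertI2, OF insertI2, OF insertI1]
   and ax5 = ax[unfolded DF_def, OF insertI2, OF insertI2, OF insertI2, OF insertI2, OF insertI1]
   and ax6 = ax[unfolded DF_def, OF insertI2, OF insertI2, OF insertI2, OF insertI2, OF insertI2,
     OF insertI1]
   and ax7 = ax[unfolded DF_def, OF insertI2, OF insertI2, OF insertI2, OF insertI2, OF insertI2,
     OF insertI2, OF insertI1]
  show ?thesis
    using assms(1) unfolding SF_def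
    using fo_provable_AllE2[OF ax1 c c] fo_provable_AllE2[OF ax2 c c] AllE[OF ax3 c]
      fo_provable_AllE2[OF ax4 c c] fo_provable_AllE2[OF ax5 c c]
      fo_provable_AllE3[OF ax6 c c c] fo_provable_AllE3[OF ax7 c c c]
    by auto
qed

section \<open>Derived rules of the first order calculus\<close>

lemma fm_in_subst: "fm_in L p \<Longrightarrow> tm_in L t \<Longrightarrow> fm_in L (subst_fm n t p)"
proof (induction p arbitrary: n t)
  case (Rel r ts)
  have "tm_in L (subst_tm n t u)" if "tm_in L u" for u
    using that Rel by (cases u) auto
  then show ?case using Rel by auto
next
  case (Eq u v)
  have "tm_in L (subst_tm n t u)" if "tm_in L u" for u
    using that Eq by (cases u) auto
  then show ?case using Eq by auto
next
  case (All p)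
  have "tm_in L (lift_tm 0 t)" using All.prems by (cases t) auto
  then show ?case using All by auto
qed auto

text \<open>Supplies the \<open>fm_in\<close> side conditions of the derived rules from their
  premises.\<close>

lemma fo_provable_in_lang: "fo_provable L S p \<Longrightarrow> fm_in L p"
  by (induction rule: fo_provable.induct) (auto intro: fm_in_subst)

lemma fo_provable_insert: "fo_provable L S p \<Longrightarrow> fo_provable L (insert q S) p"
  by (erule fo_provable_mono) auto

lemma fo_provable_AndI:
  assumes "fo_provable L S p" and "fo_provable L S q"
  shows "fo_provable L S (And p q)"
proof -
  let ?T = "insert (Imp p (Neg q)) S"
  have L: "fm_in L (Imp p (Neg q))" using assms fo_provable_in_lang by fastforce
  then have "fo_provable L ?T (Imp p (Neg q))" by (intro Assm) auto
  then have "fo_provable L ?T Falsum"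
    using assms by (meson ImpE fo_provable_insert)
  then show ?thesis by (rule ImpI[rotated]) (use L in auto)
qed

lemma fo_provable_NegNegI:
  assumes "fo_provable L S p"
  shows "fo_provable L S (Neg (Neg p))"
proof -
  have L: "fm_in L (Neg p)" using assms fo_provable_in_lang by fastforce
  then have "fo_provable L (insert (Neg p) S) Falsum"
    using assms by (meson ImpE Assm insertI1 fo_provable_insert)
  then show ?thesis by (rule ImpI[rotated]) (use L in auto)
qed

lemma fo_provable_NegNegD:
  assumes "fo_provable L S (Neg (Neg p))"
  shows "fo_provable L S p"
proof -
  have L: "fm_in L p" using assms fo_provable_in_lang by fastforce
  then have "fm_in L (Neg p)" by simp
  then have "fo_provable L (insert (Neg p) S) Falsum"
    using assms by (meson ImpE Assm insertI1 fo_provable_insert)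
  then show ?thesis by (rule RAA[rotated]) (use L in auto)
qed

lemma fo_provable_AndD:
  assumes "fo_provable L S (And p q)"
  shows "fo_provable L S p" and "fo_provable L S q"
proof -
  have L: "fm_in L p" "fm_in L q" using assms fo_provable_in_lang by fastforce+
  have "fo_provable L (insert (Neg (Neg q)) (insert p (insert (Neg p) S))) Falsum"
    by (rule ImpE[of L _ p Falsum]; rule Assm) (use L in auto)
  then have "fo_provable L (insert (Neg p) S) (Imp p (Neg q))"
    using L by (intro ImpI[OF _ RAA]) auto
  then have "fo_provable L (insert (Neg p) S) Falsum"
    using assms by (meson ImpE fo_provable_insert)
  then show "fo_provable L S p" by (rule RAA[rotated]) (use L in auto)
  have "fo_provable L (insert (Neg q) S) (Imp p (Neg q))"
    using L by (intro ImpI Assm) auto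
  then have "fo_provable L (insert (Neg q) S) Falsum"
    using assms by (meson ImpE fo_provable_insert)
  then show "fo_provable L S q" by (rule RAA[rotated]) (use L in auto)
qed

lemma fo_provable_Imp_trans:
  assumes "fo_provable L S (Imp p q)" and "fo_provable L S (Imp q r)"
  shows "fo_provable L S (Imp p r)"
proof -
  have L: "fm_in L p" using assms fo_provable_in_lang by fastforce
  then have "fo_provable L (insert p S) r"
    using assms by (meson ImpE Assm insertI1 fo_provable_insert)
  then show ?thesis by (rule ImpI[rotated]) (use L in auto)
qed

lemma fo_provable_Imp_refl: "fm_in L p \<Longrightarrow> fo_provable L S (Imp p p)"
  by (auto intro: ImpI Assm)

lemma fo_provable_contrapos:
  assumes "fo_provable L S (Imp p q)"
  shows "fo_provable L S (Imp (Neg q) (Neg p))"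
proof -
  have L: "fm_in L p" "fm_in L (Neg q)" using assms fo_provable_in_lang by fastforce+
  have "fo_provable L (insert p (insert (Neg q) S)) Falsum"
    using assms L by (meson ImpE Assm insertI1 insertI2 fo_provable_insert)
  then show ?thesis by (intro ImpI) (use L in auto)
qed

lemma fo_provable_Imp_NegNegI: "fm_in L p \<Longrightarrow> fo_provable L S (Imp p (Neg (Neg p)))"
  by (rule ImpI, assumption, rule fo_provable_NegNegI, rule Assm) auto

lemma fo_provable_Imp_NegNegD: "fm_in L p \<Longrightarrow> fo_provable L S (Imp (Neg (Neg p)) p)"
  by (rule ImpI, simp, rule fo_provable_NegNegD, rule Assm) auto

text \<open>Lifting leaves closed assumptions as they are, so generalization applies to them
  unchanged.\<close>

lemma fo_provable_AllI_closed:
  assumes "\<And>q. q \<in> S \<Longrightarrow> lift_fm 0 q = q" and "fo_provable L S p"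
  shows "fo_provable L S (All p)"
proof -
  have "lift_fm 0 ` S = S" using assms(1) by force
  then show ?thesis using assms(2) by (simp add: AllI)
qed

text \<open>The condition on \<open>p\<close> says that only index 0 occurs free in it, so that instantiating
  \<open>All p\<close> by \<open>Var 0\<close> gives back \<open>p\<close>.\<close>

lemma fo_provable_All_mono:
  assumes closed: "\<And>q. q \<in> S \<Longrightarrow> lift_fm 0 q = q"
    and p: "lift_fm (Suc 0) p = p" "subst_fm 0 (Var 0) p = p"
    and L: "fm_in L p" and imp: "\<And>T. fo_provable L T p \<Longrightarrow> fo_provable L T q"
  shows "fo_provable L S (Imp (All p) (All q))"
proof (rule ImpI)
  let ?T = "insert (All p) S"
  have "fo_provable L ?T (All p)" using L by (intro Assm) auto
  then have "fo_provable L ?T p" using AllE[of L ?T p "Var 0"] p by simp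
  then show "fo_provable L ?T (All q)"
    using closed p by (intro fo_provable_AllI_closed imp) auto
qed (use L in auto)

text \<open>The form with two premises, for the axioms behind \<open>Barbara\<close> and
  \<open>Celarent\<close>.\<close>

lemma fo_provable_All_mono2:
  assumes closed: "\<And>q. q \<in> S \<Longrightarrow> lift_fm 0 q = q"
    and p: "lift_fm (Suc 0) p = p" "subst_fm 0 (Var 0) p = p"
    and q: "lift_fm (Suc 0) q = q" "subst_fm 0 (Var 0) q = q"
    and L: "fm_in L p" "fm_in L q"
    and imp: "\<And>T. fo_provable L T p \<Longrightarrow> fo_provable L T q \<Longrightarrow> fo_provable L T r"
  shows "fo_provable L S (Imp (And (All p) (All q)) (All r))"
proof (rule ImpI)
  let ?T = "insert (And (All p) (All q)) S"
  have "fo_provable L ?T (And (All p) (All q))" using L by (intro Assm) auto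
  note fo_provable_AndD[OF this]
  then have "fo_provable L ?T p" "fo_provable L ?T q"
    using AllE[of L ?T p "Var 0"] AllE[of L ?T q "Var 0"] p q by simp_all
  then show "fo_provable L ?T (All r)"
    using closed p q by (intro fo_provable_AllI_closed imp) auto
qed (use L in auto)

section \<open>The sentential theory in monadic logic\<close>

lemma MF_sentence_closed: "lift_fm 0 (MF_sentence s) = MF_sentence s"
  by (cases s rule: contradictory.cases) auto

lemma MF_closed: "p \<in> MF P \<Longrightarrow> lift_fm 0 p = p"
  by (auto simp: MF_def)

lemma MF_sentence_in_lang: "s \<in> BN P \<Longrightarrow> fm_in (MF_lang eq P) (MF_sentence s)"
  by (cases s rule: contradictory.cases) (auto simp: MF_lang_def)

lemma MF_in_lang: "p \<in> MF P \<Longrightarrow> fm_in (MF_lang eq P) p"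
  by (auto simp: MF_def MF_lang_def)

text \<open>Of the translated axioms, only those from \<open>Apq\<close> to \<open>Iqp\<close> are
  axioms of \<open>MF\<close>; the others are validities of monadic logic, proved below the
  quantifiers and then generalized. Generalization is why the assumptions are taken to be
  closed.\<close>

lemma MF_proves_SF:
  assumes "q \<in> SF P" and closed: "\<And>p. p \<in> S \<Longrightarrow> lift_fm 0 p = p" and MF: "MF P \<subseteq> S"
  shows "fo_provable (MF_lang eq P) S (interp MF_sentence q)"
proof -
  let ?L = "MF_lang eq P"
  let ?R = "\<lambda>p. Rel p [Var 0] :: ('a, unit) fm"
  have L: "fm_in ?L (?R p)" if "p \<in> P" for p using that by (simp add: MF_lang_def)
  have 1: "fo_provable ?L S (interp MF_sentence (PIff (SF_symb qE p q) (PNeg (SF_symb qI p q))))"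
    if pq: "p \<in> P" "q \<in> P" for p q
  proof -
    \<comment> \<open>With the abbreviations unfolded, \<open>Ipq\<close> is
      \<open>Neg (All (Neg (Neg ?X)))\<close>, so up to double negations both sides are
      \<open>All ?X\<close>.\<close>
    let ?X = "Imp (?R p) (Neg (?R q))"
    have 1: "fo_provable ?L S (Imp (All ?X) (All (Neg (Neg ?X))))"
      using pq closed by (intro fo_provable_All_mono fo_provable_NegNegI) (auto simp: MF_lang_def)
    have 2: "fo_provable ?L S (Imp (All (Neg (Neg ?X))) (All ?X))"
      using pq closed by (intro fo_provable_All_mono) (auto simp: MF_lang_def intro: fo_provable_NegNegD)
    have LX: "fm_in ?L (All (Neg (Neg ?X)))" using pq by (simp add: MF_lang_def)
    show ?thesis
      using fo_provable_AndI[OF fo_provable_Imp_trans[OF 1 fo_provable_Imp_NegNegI[OF LX]]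
          fo_provable_Imp_trans[OF fo_provable_Imp_NegNegD[OF LX] 2]]
      by simp
  qed
  have 2: "fo_provable ?L S
      (interp MF_sentence (PIff (SF_symb qO p q) (PNeg (SF_symb qA p q))))"
    if pq: "p \<in> P" "q \<in> P" for p q
  proof -
    \<comment> \<open>\<open>Opq\<close> unfolds to \<open>Neg (All (Neg (Neg ?Y)))\<close> and the
      negation of \<open>Apq\<close> to \<open>Neg (All ?X)\<close>; hence the contrapositives of
      \<open>1\<close> and \<open>2\<close>.\<close>
    let ?X = "Imp (?R p) (?R q)" and ?Y = "Imp (?R p) (Neg (Neg (?R q)))"
    have XY: "fo_provable ?L T ?Y" if "fo_provable ?L T ?X" for T
      using that fo_provable_Imp_trans fo_provable_Imp_NegNegI L pq by blast
    have YX: "fo_provable ?L T ?X" if "fo_provable ?L T ?Y" for T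
      using that fo_provable_Imp_trans fo_provable_Imp_NegNegD L pq by blast
    have 1: "fo_provable ?L S (Imp (All ?X) (All (Neg (Neg ?Y))))"
      using pq closed XY by (intro fo_provable_All_mono fo_provable_NegNegI) (auto simp: MF_lang_def)
    have 2: "fo_provable ?L S (Imp (All (Neg (Neg ?Y))) (All ?X))"
      using pq closed by (intro fo_provable_All_mono YX) (auto simp: MF_lang_def intro: fo_provable_NegNegD)
    show ?thesis
      using fo_provable_AndI[OF fo_provable_contrapos[OF 1] fo_provable_contrapos[OF 2]]
      by simp
  qed
  have 3: "fo_provable ?L S (interp MF_sentence (SF_symb qA p p))" if "p \<in> P" for p
    using that L closed by (simp add: fo_provable_AllI_closed fo_provable_Imp_refl)
  have 4: "fo_provable ?L S (interp MF_sentence (PImp (SF_symb qA p q) (SF_symb qI q p)))"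
    if "p \<in> P" "q \<in> P" for p q
  proof -
    have "interp MF_sentence (PImp (SF_symb qA p q) (SF_symb qI q p)) \<in> MF P"
      using that by (auto simp: MF_def)
    then show ?thesis using MF by (intro Assm MF_in_lang) auto
  qed
  have 5: "fo_provable ?L S (interp MF_sentence (PImp (SF_symb qE p q) (SF_symb qE q p)))"
    if pq: "p \<in> P" "q \<in> P" for p q
  proof -
    have "fo_provable ?L T (Imp (?R q) (Neg (?R p)))"
      if "fo_provable ?L T (Imp (?R p) (Neg (?R q)))" for T
      using fo_provable_Imp_trans[OF fo_provable_Imp_NegNegI[OF L[OF pq(2)]]
          fo_provable_contrapos[OF that]] .
    then have "fo_provable ?L S
        (Imp (All (Imp (?R p) (Neg (?R q)))) (All (Imp (?R q) (Neg (?R p)))))"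
      using pq closed by (intro fo_provable_All_mono) (auto simp: MF_lang_def)
    then show ?thesis by simp
  qed
  have 6: "fo_provable ?L S (interp MF_sentence
      (PImp (PAnd (SF_symb qA p q) (SF_symb qA q r)) (SF_symb qA p r)))"
    if pqr: "p \<in> P" "q \<in> P" "r \<in> P" for p q r
  proof -
    have "fo_provable ?L S (Imp (And (All (Imp (?R p) (?R q))) (All (Imp (?R q) (?R r))))
        (All (Imp (?R p) (?R r))))"
      using pqr closed
      by (intro fo_provable_All_mono2) (auto simp: MF_lang_def intro: fo_provable_Imp_trans)
    then show ?thesis by simp
  qed
  have 7: "fo_provable ?L S (interp MF_sentence
      (PImp (PAnd (SF_symb qA p q) (SF_symb qE q r)) (SF_symb qE p r)))"
    if pqr: "p \<in> P" "q \<in> P" "r \<in> P" for p q r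
  proof -
    have "fo_provable ?L S (Imp (And (All (Imp (?R p) (?R q))) (All (Imp (?R q) (Neg (?R r)))))
        (All (Imp (?R p) (Neg (?R r)))))"
      using pqr closed
      by (intro fo_provable_All_mono2) (auto simp: MF_lang_def intro: fo_provable_Imp_trans)
    then show ?thesis by simp
  qed
  show ?thesis
    using assms(1) unfolding SF_def
    by (elim UnE CollectE exE conjE; simp only: 1 2 3 4 5 6 7)
qed

lemma SF_to_DF:
  assumes "prop_provable (BN C) (Symb ` \<Gamma> \<union> SF C) p" and "\<Gamma> \<subseteq> BN C"
  shows "fo_provable (DF_lang eq C) (DF_sentence ` \<Gamma> \<union> DF) (interp DF_sentence p)"
proof (rule fo_provable_interp[OF assms(1) DF_sentence_in_lang])
  fix q assume "q \<in> Symb ` \<Gamma> \<union> SF C"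
  then show "fo_provable (DF_lang eq C) (DF_sentence ` \<Gamma> \<union> DF) (interp DF_sentence q)"
  proof
    assume "q \<in> Symb ` \<Gamma>"
    then show ?thesis using assms(2) by (auto intro!: Assm DF_sentence_in_lang)
  next
    assume "q \<in> SF C"
    then show ?thesis by (rule DF_proves_SF) simp
  qed
qed

lemma SF_to_MF:
  assumes "prop_provable (BN P) (Symb ` \<Gamma> \<union> SF P) p" and "\<Gamma> \<subseteq> BN P"
  shows "fo_provable (MF_lang eq P) (MF_sentence ` \<Gamma> \<union> MF P) (interp MF_sentence p)"
proof (rule fo_provable_interp[OF assms(1) MF_sentence_in_lang])
  fix q assume "q \<in> Symb ` \<Gamma> \<union> SF P"
  then show "fo_provable (MF_lang eq P) (MF_sentence ` \<Gamma> \<union> MF P) (interp MF_sentence q)"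
  proof
    assume "q \<in> Symb ` \<Gamma>"
    then show ?thesis using assms(2) by (auto intro!: Assm MF_sentence_in_lang)
  next
    assume "q \<in> SF P"
    then show ?thesis
      by (rule MF_proves_SF) (auto simp: MF_sentence_closed MF_closed)
  qed
qed

section \<open>Models\<close>

lemma peval_SF:
  assumes "\<And>a. V a \<noteq> {}" and "q \<in> SF J"
  shows "peval (holds V) q"
proof -
  \<comment> \<open>Existential import: this is where the sets have to be nonempty.\<close>
  have "V b \<inter> V a \<noteq> {}" if "V a \<subseteq> V b" for a b
    using assms(1)[of a] that by blast
  then show ?thesis using assms(2) unfolding SF_def by (auto 0 0; blast)
qed

text \<open>The domain of this structure consists of the terms themselves: constants denote
  themselves, and the relations are read off the sets \<open>V a\<close>.\<close>

lemma sat_DF_sentence: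
  "sat (\<lambda>Y xs. holds V (Basic Y (xs ! 0) (xs ! 1))) (\<lambda>k. k) e (DF_sentence s) \<longleftrightarrow> holds V s"
  by (cases s) simp

text \<open>The quantifiers range over the whole type of terms, not just over \<open>C\<close>;
  hence nonemptiness for every \<open>a\<close>.\<close>

lemma sat_DF:
  assumes "\<And>a. V a \<noteq> {}" and "q \<in> DF"
  shows "sat (\<lambda>Y xs. holds V (Basic Y (xs ! 0) (xs ! 1))) c e q"
proof -
  have "V b \<inter> V a \<noteq> {}" if "V a \<subseteq> V b" for a b
    using assms(1)[of a] that by blast
  then show ?thesis using assms(2) unfolding DF_def by (auto 0 0 simp: numeral_2_eq_2; blast)
qed

text \<open>Here the domain consists of the points, and each unary symbol has its set as extension;
  \<open>hd\<close> extracts the single argument. The abbreviations of \<open>MF\<close> then say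
  exactly what \<open>holds\<close> says.\<close>

lemma sat_MF_sentence:
  "sat (\<lambda>p xs. hd xs \<in> V p) c e (MF_sentence s) \<longleftrightarrow> holds V s"
  by (cases s rule: contradictory.cases) auto

lemma sat_MF:
  assumes "\<And>a. V a \<noteq> {}" and "q \<in> MF P"
  shows "sat (\<lambda>p xs. hd xs \<in> V p) c e q"
proof -
  from assms(2) obtain a b where
    "q = Imp (MF_sentence (Basic qA a b)) (MF_sentence (Basic qI b a))"
    by (auto simp: MF_def)
  then show ?thesis
    using assms(1)[of a] by (auto simp only: sat.simps sat_MF_sentence holds.simps)
qed

lemma prop_provable_holds:
  assumes "prop_provable X (Symb ` \<Delta> \<union> SF J) p" and "\<And>a. V a \<noteq> {}"
    and "\<And>s. s \<in> \<Delta> \<Longrightarrow> holds V s"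
  shows "peval (holds V) p"
  using assms(1) by (rule prop_soundness) (use assms(2,3) in \<open>auto intro: peval_SF\<close>)

lemma DF_provable_sat:
  assumes "fo_provable L (DF_sentence ` \<Delta> \<union> DF) p" and "\<And>a. V a \<noteq> {}"
    and "\<And>s. s \<in> \<Delta> \<Longrightarrow> holds V s"
  shows "sat (\<lambda>Y xs. holds V (Basic Y (xs ! 0) (xs ! 1))) (\<lambda>k. k) e p"
  using assms(1)
  by (rule fo_soundness) (use assms(2,3) in \<open>auto intro: sat_DF simp only: sat_DF_sentence\<close>)

lemma MF_provable_sat:
  assumes "fo_provable L (MF_sentence ` \<Delta> \<union> MF P) p" and "\<And>a. V a \<noteq> {}"
    and "\<And>s. s \<in> \<Delta> \<Longrightarrow> holds V s"
  shows "sat (\<lambda>p xs. hd xs \<in> V p) c e p"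
  using assms(1)
  by (rule fo_soundness) (use assms(2,3) in \<open>auto intro: sat_MF simp: sat_MF_sentence\<close>)

section \<open>Equivalence of the syllogistic with the three theories\<close>

lemma not_g_derives_model:
  fixes C :: "'c set" and f :: "'c \<Rightarrow> 'j"
  assumes "\<not> g_derives C \<Gamma> s" and "\<Gamma> \<union> {s} \<subseteq> BN C" and "inj_on f C"
  obtains V :: "'j \<Rightarrow> ('c \<times> 'c) set"
  where "\<And>a. V a \<noteq> {}" and "\<And>t. t \<in> map_basic f ` \<Gamma> \<Longrightarrow> holds V t"
    and "\<not> holds V (map_basic f s)"
proof -
  \<comment> \<open>By definition, failure of \<open>g_derives\<close> is the consistency of
    \<open>\<Gamma>\<close> with the contradictory of \<open>s\<close> added; a model of that set
    makes \<open>s\<close> false.\<close>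
  have "d_consistent C (\<Gamma> \<union> {contradictory s})" "\<Gamma> \<union> {contradictory s} \<subseteq> BN C"
    using assms by (auto simp: g_derives_def)
  from d_consistent_model_map[OF this assms(3)] obtain V :: "'j \<Rightarrow> ('c \<times> 'c) set"
    where V: "\<And>a. V a \<noteq> {}"
      "\<And>t. t \<in> map_basic f ` (\<Gamma> \<union> {contradictory s}) \<Longrightarrow> holds V t"
    by blast
  from V(2)[of "map_basic f (contradictory s)"] have "\<not> holds V (map_basic f s)"
    by (simp add: map_basic_contradictory)
  then show thesis using that[of V] V by auto
qed

text \<open>Syllogistic derivations are carried into \<open>SF\<close>, which uses that
  \<open>f\<close> maps into \<open>J\<close>; conversely a model of the syllogistic side, which
  uses injectivity, refutes proofs in \<open>SF\<close>.\<close>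

lemma SF_correct:
  fixes C :: "'c set" and J :: "'j set"
  assumes f: "bij_betw f C J" and BN: "\<Gamma> \<union> {\<sigma>} \<subseteq> BN C"
  shows "d_consistent C \<Gamma> \<longleftrightarrow> prop_consistent (BN J) (Symb ` map_basic f ` \<Gamma> \<union> SF J)" (is ?A)
    and "g_derives C \<Gamma> \<sigma> \<longleftrightarrow>
      prop_provable (BN J) (Symb ` map_basic f ` \<Gamma> \<union> SF J) (Symb (map_basic f \<sigma>))" (is ?B)
proof -
  have inj: "inj_on f C" and C: "f ` C \<subseteq> J" using f by (auto simp: bij_betw_def)
  have \<Gamma>: "\<Gamma> \<subseteq> BN C" using BN by simp
  have "\<not> prop_provable (BN J) (Symb ` map_basic f ` \<Gamma> \<union> SF J) PFalsum"
    if con: "d_consistent C \<Gamma>"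
  proof
    assume "prop_provable (BN J) (Symb ` map_basic f ` \<Gamma> \<union> SF J) PFalsum"
    moreover obtain V :: "'j \<Rightarrow> ('c \<times> 'c) set" where "\<And>a. V a \<noteq> {}"
      "\<And>t. t \<in> map_basic f ` \<Gamma> \<Longrightarrow> holds V t"
      using d_consistent_model_map[OF con \<Gamma> inj] by blast
    ultimately have "peval (holds V) PFalsum" by (rule prop_provable_holds)
    then show False by simp
  qed
  then show ?A using d_inconsistent_SF[of C \<Gamma> f J] BN C by (auto simp: prop_consistent_iff)
  have "\<not> prop_provable (BN J) (Symb ` map_basic f ` \<Gamma> \<union> SF J) (Symb (map_basic f \<sigma>))"
    if not_g: "\<not> g_derives C \<Gamma> \<sigma>"
  proof
    assume "prop_provable (BN J) (Symb ` map_basic f ` \<Gamma> \<union> SF J) (Symb (map_basic f \<sigma>))"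
    moreover obtain V :: "'j \<Rightarrow> ('c \<times> 'c) set" where V: "\<And>a. V a \<noteq> {}"
      "\<And>t. t \<in> map_basic f ` \<Gamma> \<Longrightarrow> holds V t" "\<not> holds V (map_basic f \<sigma>)"
      using not_g_derives_model[OF not_g BN inj] by blast
    ultimately have "peval (holds V) (Symb (map_basic f \<sigma>))" by (intro prop_provable_holds)
    then show False using V by simp
  qed
  then show ?B using g_derives_SF[OF _ BN C] by blast
qed

text \<open>Proofs are carried over from \<open>SF C\<close> with the identity as renaming; in the
  other direction a model over the terms refutes proofs in \<open>DF\<close> directly.\<close>

lemma DF_correct:
  fixes C :: "'c set"
  assumes BN: "\<Gamma> \<union> {\<sigma>} \<subseteq> BN C"
  shows "d_consistent C \<Gamma> \<longleftrightarrow> fo_consistent (DF_lang eq C) (DF_sentence ` \<Gamma> \<union> DF)" (is ?A)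
    and "g_derives C \<Gamma> \<sigma> \<longleftrightarrow>
      fo_provable (DF_lang eq C) (DF_sentence ` \<Gamma> \<union> DF) (DF_sentence \<sigma>)" (is ?B)
proof -
  have id: "bij_betw (\<lambda>x. x) C C" by (simp add: bij_betw_def)
  note SF = SF_correct[OF id BN, unfolded basic.map_ident image_ident]
  let ?M = "\<lambda>V Y xs. holds (V :: 'c \<Rightarrow> ('c \<times> 'c) set) (Basic Y (xs ! 0) (xs ! 1))"
  have "\<not> fo_provable (DF_lang eq C) (DF_sentence ` \<Gamma> \<union> DF) Falsum"
    if con: "d_consistent C \<Gamma>"
  proof
    assume "fo_provable (DF_lang eq C) (DF_sentence ` \<Gamma> \<union> DF) Falsum"
    moreover obtain V :: "'c \<Rightarrow> ('c \<times> 'c) set" where "\<And>a. V a \<noteq> {}"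
      "\<And>s. s \<in> \<Gamma> \<Longrightarrow> holds V s"
      using d_consistent_model[OF con] BN by blast
    \<comment> \<open>\<open>undefined\<close> is an arbitrary environment; the formula evaluated
      has no free variables.\<close>
    ultimately have "sat (?M V) (\<lambda>k. k) undefined Falsum" by (intro DF_provable_sat)
    then show False by simp
  qed
  then show ?A using SF(1) SF_to_DF[of C \<Gamma> PFalsum eq] BN
    by (auto simp: prop_consistent_iff fo_consistent_iff)
  have "\<not> fo_provable (DF_lang eq C) (DF_sentence ` \<Gamma> \<union> DF) (DF_sentence \<sigma>)"
    if not_g: "\<not> g_derives C \<Gamma> \<sigma>"
  proof
    assume "fo_provable (DF_lang eq C) (DF_sentence ` \<Gamma> \<union> DF) (DF_sentence \<sigma>)"
    moreover obtain V :: "'c \<Rightarrow> ('c \<times> 'c) set" where V: "\<And>a. V a \<noteq> {}"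
      "\<And>t. t \<in> \<Gamma> \<Longrightarrow> holds V t" "\<not> holds V \<sigma>"
      using not_g_derives_model[OF not_g BN bij_betw_imp_inj_on[OF id],
          unfolded basic.map_ident image_ident] by blast
    ultimately have "sat (?M V) (\<lambda>k. k) undefined (DF_sentence \<sigma>)" by (intro DF_provable_sat)
    then show False using V by (simp only: sat_DF_sentence)
  qed
  then show ?B using SF(2) SF_to_DF[of C \<Gamma> "Symb \<sigma>" eq] BN by auto
qed

text \<open>As for \<open>DF\<close>, but with \<open>SF P\<close> and the renaming
  \<open>H\<close>, so that the terms become the predicates of the language.\<close>

lemma MF_correct:
  fixes C :: "'c set" and P :: "'p set"
  assumes H: "bij_betw H C P" and BN: "\<Gamma> \<union> {\<sigma>} \<subseteq> BN C"
  shows "d_consistent C \<Gamma> \<longleftrightarrow>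
      fo_consistent (MF_lang eq P) (MF_sentence ` map_basic H ` \<Gamma> \<union> MF P)" (is ?A)
    and "g_derives C \<Gamma> \<sigma> \<longleftrightarrow>
      fo_provable (MF_lang eq P) (MF_sentence ` map_basic H ` \<Gamma> \<union> MF P)
        (MF_sentence (map_basic H \<sigma>))" (is ?B)
proof -
  have inj: "inj_on H C" and C: "H ` C \<subseteq> P" using H by (auto simp: bij_betw_def)
  have \<Gamma>: "\<Gamma> \<subseteq> BN C" using BN by simp
  have BNP: "map_basic H ` \<Gamma> \<subseteq> BN P" using BN C by (blast intro: map_basic_in_BN)
  note SF = SF_correct[OF H BN]
  let ?M = "\<lambda>V p xs. hd xs \<in> (V :: 'p \<Rightarrow> ('c \<times> 'c) set) p"
  have "\<not> fo_provable (MF_lang eq P) (MF_sentence ` map_basic H ` \<Gamma> \<union> MF P) Falsum"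
    if con: "d_consistent C \<Gamma>"
  proof
    assume "fo_provable (MF_lang eq P) (MF_sentence ` map_basic H ` \<Gamma> \<union> MF P) Falsum"
    moreover obtain V :: "'p \<Rightarrow> ('c \<times> 'c) set" where "\<And>a. V a \<noteq> {}"
      "\<And>t. t \<in> map_basic H ` \<Gamma> \<Longrightarrow> holds V t"
      using d_consistent_model_map[OF con \<Gamma> inj] by blast
    \<comment> \<open>The language has no constants, so their interpretation, like the environment,
      is arbitrary.\<close>
    ultimately have "sat (?M V) (\<lambda>_ :: unit. undefined) undefined Falsum"
      by (rule MF_provable_sat)
    then show False by simp
  qed
  then show ?A using SF(1) SF_to_MF[of P "map_basic H ` \<Gamma>" PFalsum eq] BNP
    by (auto simp: prop_consistent_iff fo_consistent_iff)
  have "\<not> fo_provable (MF_lang eq P) (MF_sentence ` map_basic H ` \<Gamma> \<union> MF P)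
      (MF_sentence (map_basic H \<sigma>))"
    if not_g: "\<not> g_derives C \<Gamma> \<sigma>"
  proof
    assume "fo_provable (MF_lang eq P) (MF_sentence ` map_basic H ` \<Gamma> \<union> MF P)
      (MF_sentence (map_basic H \<sigma>))"
    moreover obtain V :: "'p \<Rightarrow> ('c \<times> 'c) set" where V: "\<And>a. V a \<noteq> {}"
      "\<And>t. t \<in> map_basic H ` \<Gamma> \<Longrightarrow> holds V t" "\<not> holds V (map_basic H \<sigma>)"
      using not_g_derives_model[OF not_g BN inj] by blast
    ultimately have "sat (?M V) undefined undefined (MF_sentence (map_basic H \<sigma>))"
      by (intro MF_provable_sat)
    then show False using V by (simp only: sat_MF_sentence)
  qed
  then show ?B
    using SF(2) SF_to_MF[of P "map_basic H ` \<Gamma>" "Symb (map_basic H \<sigma>)" eq] BNP by auto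
qed

text \<open>An arbitrary \<open>eq\<close> covers the languages with and without equality at
  once.\<close>

theorem theorem4p1:
  fixes C :: "'c set" and J :: "'j set" and P :: "'p set"
    and h :: "'c \<Rightarrow> 'j" and H :: "'c \<Rightarrow> 'p"
    and \<Gamma> :: "'c basic set" and \<sigma> :: "'c basic"
    and eq :: bool
  assumes "\<exists>X\<subseteq>C. card X = 3" and "\<exists>X\<subseteq>J. card X = 3" and "\<exists>X\<subseteq>P. card X = 3"
    and "bij_betw h C J" and "bij_betw H C P"
    and "\<Gamma> \<union> {\<sigma>} \<subseteq> BN C"
  shows
    "(d_consistent C \<Gamma> \<longleftrightarrow> fo_consistent (DF_lang eq C) (DF_sentence ` \<Gamma> \<union> DF)) \<and>
     (g_derives C \<Gamma> \<sigma> \<longleftrightarrow> fo_provable (DF_lang eq C) (DF_sentence ` \<Gamma> \<union> DF) (DF_sentence \<sigma>)) \<and>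
     (d_consistent C \<Gamma> \<longleftrightarrow>
        prop_consistent (BN J) (Symb ` map_basic h ` \<Gamma> \<union> SF J)) \<and>
     (g_derives C \<Gamma> \<sigma> \<longleftrightarrow>
        prop_provable (BN J) (Symb ` map_basic h ` \<Gamma> \<union> SF J) (Symb (map_basic h \<sigma>))) \<and>
     (d_consistent C \<Gamma> \<longleftrightarrow>
        fo_consistent (MF_lang eq P) (MF_sentence ` map_basic H ` \<Gamma> \<union> MF P)) \<and>
     (g_derives C \<Gamma> \<sigma> \<longleftrightarrow>
        fo_provable (MF_lang eq P) (MF_sentence ` map_basic H ` \<Gamma> \<union> MF P)
          (MF_sentence (map_basic H \<sigma>)))"
  using DF_correct[OF assms(6)] SF_correct[OF assms(4,6)] MF_correct[OF assms(5,6)]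
  by (intro conjI)

end
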